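(* Let $D$ be a division algebra of finite dimension $m>1$ over its center $F=C(D)$, and let $v_1,\dots,v_m$ be an $F$-linear basis of $D$. Let $b_{st}^{i}\in F$ ($1\le i,s,t\le m$) be the unique elements such that for every $x=\sum_{i=1}^m c_iv_i\in D$ (with $c_i\in F$) one has $c_i=\sum_{s=1}^m\sum_{t=1}^m b_{st}^{i}v_sxv_t$ for all $1\le i\le m$. Consider the following elements $Y_{ij}\in D[x_1,\dots,x_n]$ (for $1\le i\le n$, $1\le j\le m$): $$Y_{ij}=\sum_{s=1}^m\sum_{t=1}^m b_{st}^{j}\,v_s x_i v_t .$$ Then there exists a unique isomorphism $$\phi: D[x_1,\dots,x_n]\xrightarrow{\ \sim\ } D_c[y_{ij}:1\le i\le n,\ 1\le j\le m]$$ satisfying $\phi(Y_{ij})=y_{ij}$ for all $i,j$. Moreover, for any $(a_{ij})\in M_{n\times m}(F)$ and any $f\in D[x_1,\dots,x_n]$, $$f\Big(\sum_{j=1}^m a_{1j}v_j,\ \dots,\ \sum_{j=1}^m a_{nj}v_j\Big)=\phi(f)\big((a_{ij})\big).$$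
   Context: $D[x_1,\dots,x_n]$ denotes the ring of polynomial functions over $D$: all functions $f:D^n\to D$ expressible in the form $$f(x_1,\dots,x_n)=\sum_{l=1}^{r}a_{l,1}x_{\mu_{l,1}}a_{l,2}x_{\mu_{l,2}}\cdots a_{l,k_l}x_{\mu_{l,k_l}}a_{l,k_l+1}$$ with $r\ge 0$, $k_l\ge 0$, $\mu_{l,p}\in\{1,\dots,n\}$, $a_{l,p}\in D$, with pointwise addition and multiplication. Here $x_i$ is the $i$-th coordinate function. $D_c[y_1,\dots,y_k]$ denotes the ring of polynomials over $D$ in $k$ central variables: its elements are finite formal sums $\sum_I a_I y^I$ over multi-indices $I\in\mathbb{Z}_{\ge0}^k$ with $a_I\in D$, with multiplication $(\sum_I a_Iy^I)(\sum_J b_Jy^J)=\sum_{I,J} a_Ib_J y^{I+J}$. An element $g=\sum_I a_Iy^I$ is evaluated at a point $c\in F^k$ by $g(c)=\sum_I a_Ic^I$. In the claim the variables are $y_{ij}$, $1\le i\le n$, $1\le j\le m$, and evaluation at $(a_{ij})$ means substituting $y_{ij}=a_{ij}$. The isomorphism in question is an isomorphism of rings. The existence and uniqueness of the constants $b_{st}^i$ is an established fact that is part of the setting.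
   Formalization: "Isomorphism" is taken to mean a ring isomorphism that is the identity on the constants D; among all ring isomorphisms uniqueness fails, since conjugating all coefficients by a noncentral element of D fixes every y_ij and yields another one. *)

theory Defs
  imports
    "HOL-Algebra.Algebraic_Closure_Type"
    "HOL-Library.Poly_Mapping"
begin

typedef (overloaded) 'a center = "{z :: 'a :: division_ring. \<forall>x. z * x = x * z}"
  morphisms of_center Abs_center
  by (rule exI[of _ 0]) simp

setup_lifting type_definition_center

instantiation center :: (division_ring) field
begin

lift_definition zero_center :: "'a center" is 0 by simp
lift_definition one_center :: "'a center" is 1 by simp
lift_definition plus_center :: "'a center \<Rightarrow> 'a center \<Rightarrow> 'a center" is "(+)"
  by (simp add: algebra_simps)
lift_definition minus_center :: "'a center \<Rightarrow> 'a center \<Rightarrow> 'a center" is "(-)"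
  by (simp add: algebra_simps)
lift_definition uminus_center :: "'a center \<Rightarrow> 'a center" is uminus
  by simp
lift_definition times_center :: "'a center \<Rightarrow> 'a center \<Rightarrow> 'a center" is "(*)"
  by (metis mult.assoc)

lemma inverse_in_center:
  fixes z :: "'a :: division_ring"
  assumes "\<forall>x. z * x = x * z"
  shows "inverse z * x = x * inverse z"
proof (cases "z = 0")
  case False
  have "inverse z * x = inverse z * (x * z) * inverse z"
    using False by (simp add: mult.assoc)
  also have "\<dots> = inverse z * (z * x) * inverse z"
    using assms by simp
  also have "\<dots> = x * inverse z"
    using False by (simp add: mult.assoc[symmetric])
  finally show ?thesis .
qed simp

lift_definition inverse_center :: "'a center \<Rightarrow> 'a center" is inverse
  using inverse_in_center by blast

definition divide_center :: "'a center \<Rightarrow> 'a center \<Rightarrow> 'a center"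
  where "divide_center x y = x * inverse y"

instance
proof
  fix x y z :: "'a center"
  show "x + y + z = x + (y + z)" by transfer (rule add.assoc)
  show "x + y = y + x" by transfer (rule add.commute)
  show "0 + x = x" by transfer (rule add_0_left)
  show "- x + x = 0" by transfer (rule left_minus)
  show "x - y = x + - y" by transfer (rule diff_conv_add_uminus)
  show "x * y * z = x * (y * z)" by transfer (rule mult.assoc)
  show "x * y = y * x" by transfer blast
  show "1 * x = x" by transfer (rule mult_1_left)
  show "(x + y) * z = x * z + y * z" by transfer (rule distrib_right)
  show "(0 :: 'a center) \<noteq> 1" by transfer (rule zero_neq_one)
  show "x \<noteq> 0 \<Longrightarrow> inverse x * x = 1" by transfer (rule left_inverse)
  show "x div y = x * inverse y" by (rule divide_center_def)
  show "inverse (0 :: 'a center) = 0" by transfer (rule inverse_zero)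
qed

end

definition center_scale :: "'a :: division_ring center \<Rightarrow> 'a \<Rightarrow> 'a"
  where "center_scale z x = of_center z * x"

interpretation center: vector_space "center_scale :: 'a :: division_ring center \<Rightarrow> 'a \<Rightarrow> 'a"
  by standard
    (simp_all add: center_scale_def plus_center.rep_eq times_center.rep_eq one_center.rep_eq
      algebra_simps)

definition center_basis :: "('m \<Rightarrow> 'a :: division_ring) \<Rightarrow> bool"
  where "center_basis v \<longleftrightarrow>
    inj v \<and> center.independent (range v) \<and> center.span (range v) = UNIV"

text \<open>The pair \<open>([(a\<^sub>1, \<mu>\<^sub>1), \<dots>, (a\<^sub>k, \<mu>\<^sub>k)], b)\<close> encodes the generalized monomial
  \<open>a\<^sub>1 x\<^sub>\<mu>\<^sub>1 \<cdots> a\<^sub>k x\<^sub>\<mu>\<^sub>k b\<close>, with coefficients interleaved with the variables.\<close>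

definition gen_monom_eval :: "('a \<times> 'n) list \<times> 'a \<Rightarrow> ('n \<Rightarrow> 'a) \<Rightarrow> 'a :: division_ring"
  where "gen_monom_eval w x = (\<Prod>(a, \<mu>)\<leftarrow>fst w. a * x \<mu>) * snd w"

definition poly_funs :: "(('n \<Rightarrow> 'a) \<Rightarrow> 'a :: division_ring) set"
  where "poly_funs = {f. \<exists>ws. f = (\<lambda>x. \<Sum>w\<leftarrow>ws. gen_monom_eval w x)}"

definition poly_fun_ring :: "(('n \<Rightarrow> 'a) \<Rightarrow> 'a :: division_ring) ring"
  where "poly_fun_ring = \<lparr>
    carrier = poly_funs,
    monoid.mult = (\<lambda>f g x. f x * g x),
    one = (\<lambda>x. 1),
    ring.zero = (\<lambda>x. 0),
    add = (\<lambda>f g x. f x + g x)\<rparr>"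

text \<open>Polynomials over \<open>'a\<close> in central variables indexed by \<open>'k\<close>: the monoid algebra of the
  multi-indices \<open>'k \<Rightarrow>\<^sub>0 nat\<close>, whose multiplication is the convolution
  \<open>(\<Sum>\<^sub>I a\<^sub>I y\<^sup>I) (\<Sum>\<^sub>J b\<^sub>J y\<^sup>J) = \<Sum>\<^sub>I\<^sub>J a\<^sub>I b\<^sub>J y\<^sup>I\<^sup>+\<^sup>J\<close>, also for noncommutative \<open>'a\<close>.\<close>

type_synonym ('a, 'k) central_poly = "('k \<Rightarrow>\<^sub>0 nat) \<Rightarrow>\<^sub>0 'a"

definition central_const :: "'a \<Rightarrow> ('a :: division_ring, 'k) central_poly"
  where "central_const d = Poly_Mapping.single 0 d"

definition central_var :: "'k \<Rightarrow> ('a :: division_ring, 'k) central_poly"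
  where "central_var p = Poly_Mapping.single (Poly_Mapping.single p 1) 1"

definition central_eval ::
    "('a :: division_ring, 'k :: finite) central_poly \<Rightarrow> ('k \<Rightarrow> 'a center) \<Rightarrow> 'a"
  where "central_eval g c =
    (\<Sum>I\<in>Poly_Mapping.keys g.
      Poly_Mapping.lookup g I * of_center (\<Prod>p\<in>UNIV. c p ^ Poly_Mapping.lookup I p))"

definition central_poly_ring :: "('a :: division_ring, 'k) central_poly ring"
  where "central_poly_ring = ring_of_type_algebra"

text \<open>Isomorphisms of rings over \<open>'a\<close>: both rings contain a copy of \<open>'a\<close> (constant functions and
  constant polynomials), and an isomorphism has to respect it. Without this condition,
  composing with an inner automorphism of \<open>'a\<close> applied to all coefficients would give further
  ring isomorphisms with the same values on the coordinate functions below.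
  Extensionality fixes the irrelevant values outside the carrier, so that equality of maps is
  equality on \<open>poly_funs\<close>.\<close>

definition poly_fun_isos ::
    "((('n \<Rightarrow> 'a :: division_ring) \<Rightarrow> 'a) \<Rightarrow> ('a, 'k) central_poly) set"
  where "poly_fun_isos =
    {\<phi> \<in> ring_iso poly_fun_ring central_poly_ring \<inter> extensional poly_funs.
      \<forall>d. \<phi> (\<lambda>x. d) = central_const d}"

definition coord_fun ::
    "('m \<Rightarrow> 'a) \<Rightarrow> ('m \<Rightarrow> 'm \<Rightarrow> 'm \<Rightarrow> 'a center) \<Rightarrow> 'n \<Rightarrow> 'm :: finite \<Rightarrow>
      ('n \<Rightarrow> 'a) \<Rightarrow> 'a :: division_ring"
  where "coord_fun v b i j =
    (\<lambda>x. \<Sum>s\<in>UNIV. \<Sum>t\<in>UNIV. center_scale (b j s t) (v s * x i * v t))"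

end

theory Submission
  imports Defs
begin

text \<open>
  Let \<open>D\<close> be the division ring and \<open>F\<close> its center. Substituting for \<open>y\<^sub>i\<^sub>j\<close> the \<open>j\<close>-th coordinate of \<open>x\<^sub>i\<close>
  turns a central polynomial into a function on \<open>D\<^sup>n\<close>. This map, \<open>poly_fun_of\<close> below, is a ring
  homomorphism since the coordinates are central. The isomorphism of the theorem is its inverse, so
  that the value \<open>\<phi> Y\<^sub>i\<^sub>j = y\<^sub>i\<^sub>j\<close> and the evaluation formula hold by construction.

  The image of the map is the ring of polynomial functions (\<open>range_poly_fun_of\<close>): the coordinate
  formula exhibits \<open>Y\<^sub>i\<^sub>j\<close> as a polynomial function, and conversely \<open>x\<^sub>i = \<Sum>\<^sub>j Y\<^sub>i\<^sub>j v\<^sub>j\<close>. Uniqueness holds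
  because constants and variables generate the ring of central polynomials and an isomorphism over
  \<open>D\<close> with \<open>\<phi> Y\<^sub>i\<^sub>j = y\<^sub>i\<^sub>j\<close> is prescribed on their counterparts.

  The substance lies in injectivity (\<open>inj_poly_fun_of\<close>): a central polynomial that vanishes on all
  of \<open>F\<^bsup>n m\<^esup>\<close> must be zero. If \<open>F\<close> is infinite, distinct monomials are distinct multiplicative
  characters of \<open>F\<^bsup>n m\<^esup>\<close>, and Dedekind's argument shows that they are linearly independent over \<open>D\<close>
  (\<open>eval_monom_independent\<close>). That \<open>F\<close> is infinite follows from \<open>m > 1\<close>: otherwise \<open>D\<close> would be
  finite, hence commutative by Wedderburn's theorem (\<open>wedderburn_little\<close>), and then \<open>m = 1\<close>.

  Wedderburn's theorem is proved by counting in a minimal noncommutative finite division ring \<open>S\<close>.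
  A comparison of dimensions (\<open>card_minimal_noncommutative\<close>) shows that the centralizers of all
  noncentral elements are equally large; then so are their conjugacy classes, and the class equation
  becomes a single divisibility that fails for reasons of size.
\<close>

section \<open>Subrings and relations over a division ring\<close>

definition division_subring :: "'a :: division_ring set \<Rightarrow> bool"
  where "division_subring S \<longleftrightarrow> 1 \<in> S \<and>
    (\<forall>x\<in>S. \<forall>y\<in>S. x - y \<in> S \<and> x * y \<in> S) \<and> (\<forall>x\<in>S. inverse x \<in> S)"

text \<open>The centralizer is taken inside a given set, because Wedderburn's theorem is proved by
  descent to a minimal subring, where "center" and "centralizer" refer to that subring.\<close>

definition centralizer_in :: "'a :: division_ring set \<Rightarrow> 'a set \<Rightarrow> 'a set"
  where "centralizer_in S A = {x \<in> S. \<forall>a\<in>A. x * a = a * x}"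

lemma division_subringD:
  assumes "division_subring S"
  shows "1 \<in> S" "0 \<in> S" "x \<in> S \<Longrightarrow> y \<in> S \<Longrightarrow> x - y \<in> S" "x \<in> S \<Longrightarrow> y \<in> S \<Longrightarrow> x * y \<in> S"
    "x \<in> S \<Longrightarrow> inverse x \<in> S" "x \<in> S \<Longrightarrow> - x \<in> S" "x \<in> S \<Longrightarrow> y \<in> S \<Longrightarrow> x + y \<in> S"
proof -
  note def = assms[unfolded division_subring_def]
  show one: "1 \<in> S" and diff: "\<And>x y. x \<in> S \<Longrightarrow> y \<in> S \<Longrightarrow> x - y \<in> S" and "x \<in> S \<Longrightarrow> y \<in> S \<Longrightarrow> x * y \<in> S"
    and "x \<in> S \<Longrightarrow> inverse x \<in> S"
    using def by blast+
  show zero: "0 \<in> S" using diff[OF one one] by simp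
  show neg: "- x \<in> S" if "x \<in> S" for x using diff[OF zero that] by simp
  show "x + y \<in> S" if "x \<in> S" "y \<in> S" using diff[OF that(1) neg[OF that(2)]] by simp
qed

lemma division_subring_sum:
  assumes "division_subring S" "\<And>i. i \<in> I \<Longrightarrow> f i \<in> S"
  shows "sum f I \<in> S"
  using assms(2)
  by (induction I rule: infinite_finite_induct) (auto intro: division_subringD[OF assms(1)])

lemma division_subring_UNIV: "division_subring UNIV"
  by (simp add: division_subring_def)

lemma division_subring_centralizer:
  assumes "division_subring S"
  shows "division_subring (centralizer_in S A)"
proof -
  have "inverse x * a = a * inverse x" if "x * a = a * x" for x a :: 'a
  proof (cases "x = 0")
    case False
    have "a * inverse x = inverse x * (x * a) * inverse x"
      using False by (simp add: mult.assoc[symmetric])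
    also have "\<dots> = inverse x * a"
      using False by (simp add: that mult.assoc)
    finally show ?thesis by simp
  qed simp
  moreover have "x * y * a = a * (x * y)" if "x * a = a * x" "y * a = a * y" for x y a :: 'a
    using that by (metis mult.assoc)
  ultimately show ?thesis
    using division_subringD[OF assms] unfolding division_subring_def centralizer_in_def
    by (auto simp: left_diff_distrib right_diff_distrib)
qed

lemma card_division_subring:
  assumes "division_subring S" "finite S"
  shows "card S \<ge> 2"
proof -
  have "card {0, 1 :: 'a} \<le> card S"
    by (rule card_mono) (use assms division_subringD[OF assms(1)] in auto)
  then show ?thesis by simp
qed

text \<open>Every finite module over a finite division ring is free, so its cardinality is a power of the
  cardinality of the scalars. The scalar action is a parameter, so that the lemma yields both bases
  of \<open>V\<close> as a left space (\<open>act = (*)\<close>) and, over commutative \<open>K\<close>, bases as a right space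
  (\<open>act k x = x * k\<close>); both occur below. The proof takes a maximal independent subset.\<close>

lemma exists_basis_of_action:
  fixes act :: "'a :: division_ring \<Rightarrow> 'a \<Rightarrow> 'a"
  assumes K: "division_subring K" and "finite K" and "finite V"
    and V: "0 \<in> V" "\<And>x y. x \<in> V \<Longrightarrow> y \<in> V \<Longrightarrow> x + y \<in> V"
    and act: "\<And>k x. k \<in> K \<Longrightarrow> x \<in> V \<Longrightarrow> act k x \<in> V"
      "\<And>k x y. act k (x + y) = act k x + act k y"
      "\<And>k l x. act (k + l) x = act k x + act l x"
      "\<And>k l x. k \<in> K \<Longrightarrow> l \<in> K \<Longrightarrow> act (k * l) x = act k (act l x)"
      "\<And>x. act 1 x = x"
  obtains B where "B \<subseteq> V" "card V = card K ^ card B"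
    "\<And>x. x \<in> V \<Longrightarrow> \<exists>c. (\<forall>b\<in>B. c b \<in> K) \<and> x = (\<Sum>b\<in>B. act (c b) b)"
    "\<And>c. (\<And>b. b \<in> B \<Longrightarrow> c b \<in> K) \<Longrightarrow> (\<Sum>b\<in>B. act (c b) b) = 0 \<Longrightarrow> \<forall>b\<in>B. c b = 0"
proof -
  note Kc = division_subringD[OF K]
  have act0: "act k 0 = 0" "act 0 x = 0" for k x
    using act(2)[of k 0 0] act(3)[of 0 0 x] by simp_all
  have act_neg: "act (- k) x = - act k x" for k x
    using act(3)[of "- k" k x] by (simp add: act0 eq_neg_iff_add_eq_0)
  have act_diff: "act (k - l) x = act k x - act l x" for k l x
    using act(3)[of k "- l" x] by (simp add: act_neg)
  have act_neg': "act k (- x) = - act k x" for k x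
    using act(2)[of k "- x" x] by (simp add: act0 eq_neg_iff_add_eq_0)
  have act_sum: "act k (sum f I) = (\<Sum>i\<in>I. act k (f i))" for k f and I :: "'a set"
    by (induction I rule: infinite_finite_induct) (auto simp: act0 act(2))
  define indep where "indep B \<longleftrightarrow>
    (\<forall>c. (\<forall>b\<in>B. c b \<in> K) \<and> (\<Sum>b\<in>B. act (c b) b) = 0 \<longrightarrow> (\<forall>b\<in>B. c b = 0))" for B
  have "finite {B. B \<subseteq> V \<and> indep B}" "{} \<in> {B. B \<subseteq> V \<and> indep B}"
    using \<open>finite V\<close> by (auto simp: indep_def)
  then obtain B where B: "B \<subseteq> V" "indep B"
    and max: "\<And>B'. B' \<subseteq> V \<Longrightarrow> indep B' \<Longrightarrow> B \<subseteq> B' \<Longrightarrow> B' = B"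
    using finite_has_maximal[of "{B. B \<subseteq> V \<and> indep B}"]
    by (metis (mono_tags, lifting) empty_iff mem_Collect_eq)
  have finB: "finite B" using B(1) \<open>finite V\<close> finite_subset by blast
  have span: "\<exists>c. (\<forall>b\<in>B. c b \<in> K) \<and> x = (\<Sum>b\<in>B. act (c b) b)" if "x \<in> V" for x
  proof (cases "x \<in> B")
    case True
    have "x = (\<Sum>b\<in>B. if b = x then act 1 x else 0)"
      using True finB act(5) by simp
    also have "\<dots> = (\<Sum>b\<in>B. act (if b = x then 1 else 0) b)"
      by (rule sum.cong) (auto simp: act0)
    finally show ?thesis using Kc(1,2) by (intro exI[of _ "\<lambda>b. if b = x then 1 else 0"]) auto
  next
    case False
    have "\<not> indep (insert x B)" using max[of "insert x B"] False B(1) that by blast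
    then obtain c where c: "\<forall>b\<in>insert x B. c b \<in> K" "(\<Sum>b\<in>insert x B. act (c b) b) = 0"
      "\<exists>b\<in>insert x B. c b \<noteq> 0"
      unfolding indep_def by blast
    have eq: "act (c x) x = - (\<Sum>b\<in>B. act (c b) b)"
      using c(2) False finB by (simp add: eq_neg_iff_add_eq_0)
    have "c x \<noteq> 0"
      using eq c(1,3) B(2) unfolding indep_def by (auto simp: act0)
    let ?i = "- inverse (c x)"
    have i: "?i \<in> K" using c(1) Kc(5,6) by blast
    have "x = act (inverse (c x) * c x) x" using \<open>c x \<noteq> 0\<close> by (simp add: act(5))
    also have "\<dots> = act (inverse (c x)) (act (c x) x)"
      by (rule act(4)) (use c(1) Kc(5) in auto)
    also have "\<dots> = act ?i (\<Sum>b\<in>B. act (c b) b)"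
      by (simp add: eq act_neg act_neg')
    also have "\<dots> = (\<Sum>b\<in>B. act (?i * c b) b)"
      unfolding act_sum by (intro sum.cong refl act(4)[symmetric] i) (use c(1) in auto)
    finally show ?thesis
      using Kc(4)[OF i] c(1) by (intro exI[of _ "\<lambda>b. ?i * c b"]) blast
  qed
  have "bij_betw (\<lambda>c. \<Sum>b\<in>B. act (c b) b) (B \<rightarrow>\<^sub>E K) V"
    unfolding bij_betw_def
  proof (intro conjI inj_onI)
    fix c d assume cd: "c \<in> B \<rightarrow>\<^sub>E K" "d \<in> B \<rightarrow>\<^sub>E K"
      and eq: "(\<Sum>b\<in>B. act (c b) b) = (\<Sum>b\<in>B. act (d b) b)"
    have "(\<Sum>b\<in>B. act (c b - d b) b) = 0"
      using eq by (simp add: act_diff sum_subtractf)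
    moreover have "\<forall>b\<in>B. c b - d b \<in> K" using cd Kc(3) by auto
    ultimately have "\<forall>b\<in>B. c b - d b = 0"
      using B(2)[unfolded indep_def, rule_format, of "\<lambda>b. c b - d b"] by blast
    then show "c = d" using cd by (intro PiE_ext[of c B "\<lambda>_. K" d]) auto
  next
    have "(\<Sum>b\<in>C. act (c b) b) \<in> V" if "C \<subseteq> B" "\<forall>b\<in>B. c b \<in> K" for c C
      using finite_subset[OF that(1) finB] that
      by (induction C rule: finite_induct) (use V act(1) B(1) in auto)
    moreover have "\<exists>c\<in>B \<rightarrow>\<^sub>E K. x = (\<Sum>b\<in>B. act (c b) b)" if x: "x \<in> V" for x
    proof -
      obtain c where "\<forall>b\<in>B. c b \<in> K" "x = (\<Sum>b\<in>B. act (c b) b)" using span[OF x] by blast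
      then show ?thesis by (intro bexI[of _ "restrict c B"]) auto
    qed
    ultimately show "(\<lambda>c. \<Sum>b\<in>B. act (c b) b) ` (B \<rightarrow>\<^sub>E K) = V" by fast
  qed
  then have "card V = card (B \<rightarrow>\<^sub>E K)" by (rule bij_betw_same_card[symmetric])
  then have "card V = card K ^ card B" using finB by (simp add: card_PiE)
  then show thesis
    by (rule that[OF B(1) _ span]) (use B(2) in \<open>simp_all add: indep_def\<close>)
qed

text \<open>The noncommutative analogue of the independence of characters. A relation
  \<open>\<Sum> r\<^sub>x k x = 0\<close> that holds for all \<open>k \<in> K\<close>, made shortest and normalised to have a coefficient \<open>1\<close>,
  has all its coefficients in the centralizer of \<open>K\<close>: otherwise the commutator of the coefficients
  with some \<open>l \<in> K\<close> would give a shorter one. Setting \<open>k = 1\<close> then gives a linear relation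
  between the elements \<open>x\<close> themselves.\<close>

lemma twisted_relation_yields_relation:
  fixes r :: "'a :: division_ring \<Rightarrow> 'a"
  assumes S: "division_subring S" and K: "division_subring K" "K \<subseteq> S"
    and "finite A" and "\<And>x. x \<in> A \<Longrightarrow> r x \<in> S"
    and "\<And>k. k \<in> K \<Longrightarrow> (\<Sum>x\<in>A. r x * k * x) = 0"
    and "\<exists>x\<in>A. r x \<noteq> 0"
  shows "\<exists>c. (\<forall>x\<in>A. c x \<in> centralizer_in S K) \<and> (\<exists>x\<in>A. c x \<noteq> 0) \<and> (\<Sum>x\<in>A. c x * x) = 0"
  using assms(5-7)
proof (induction "card {x \<in> A. r x \<noteq> 0}" arbitrary: r rule: less_induct)
  case less
  note Sc = division_subringD[OF S] and Kc = division_subringD[OF K(1)]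
  obtain x0 where x0: "x0 \<in> A" "r x0 \<noteq> 0" using less.prems(3) by blast
  define s where "s x = inverse (r x0) * r x" for x
  have s: "s x \<in> S" if "x \<in> A" for x
    using that x0 less.prems(1) Sc(4,5) by (auto simp: s_def)
  have s0: "s x0 = 1" using x0 by (simp add: s_def)
  have rel: "(\<Sum>x\<in>A. s x * k * x) = 0" if "k \<in> K" for k
    using less.prems(2)[OF that] by (simp add: s_def mult.assoc sum_distrib_left[symmetric])
  show ?case
  proof (cases "\<forall>x\<in>A. \<forall>l\<in>K. s x * l = l * s x")
    case True
    then show ?thesis
      using s s0 x0(1) rel[OF Kc(1)]
      by (intro exI[of _ s]) (auto simp: centralizer_in_def intro!: bexI[of _ x0])
  next
    case False
    then obtain x1 l where x1: "x1 \<in> A" "l \<in> K" "s x1 * l \<noteq> l * s x1" by blast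
    \<comment> \<open>Twisting the relation by \<open>l\<close> cancels the term with coefficient \<open>1\<close>, so the
      relation becomes shorter, but it stays nontrivial.\<close>
    define t where "t x = s x * l - l * s x" for x
    have "{x \<in> A. t x \<noteq> 0} \<subset> {x \<in> A. r x \<noteq> 0}"
    proof
      show "{x \<in> A. t x \<noteq> 0} \<subseteq> {x \<in> A. r x \<noteq> 0}" by (auto simp: t_def s_def)
      have "t x0 = 0" by (simp add: t_def s0)
      then show "{x \<in> A. t x \<noteq> 0} \<noteq> {x \<in> A. r x \<noteq> 0}" using x0 by blast
    qed
    then have "card {x \<in> A. t x \<noteq> 0} < card {x \<in> A. r x \<noteq> 0}"
      using \<open>finite A\<close> by (intro psubset_card_mono) auto
    moreover have "t x \<in> S" if "x \<in> A" for x
      using s[OF that] x1(2) K(2) Sc(3,4) by (auto simp: t_def)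
    moreover have "(\<Sum>x\<in>A. t x * k * x) = 0" if "k \<in> K" for k
    proof -
      have "(\<Sum>x\<in>A. t x * k * x) = (\<Sum>x\<in>A. s x * (l * k) * x) - l * (\<Sum>x\<in>A. s x * k * x)"
        by (simp add: t_def algebra_simps sum_subtractf sum_distrib_left)
      then show ?thesis using rel[OF that] rel[OF Kc(4)[OF x1(2) that]] by simp
    qed
    moreover have "\<exists>x\<in>A. t x \<noteq> 0" using x1 by (auto simp: t_def)
    ultimately show ?thesis by (rule less.hyps)
  qed
qed

section \<open>Wedderburn's theorem on finite division rings\<close>

text \<open>In a minimal finite noncommutative division ring \<open>S\<close> with center \<open>Z\<close>, the centralizer \<open>K\<close> of a
  noncentral element is a field that is its own centralizer, and \<open>[S : K] = [K : Z]\<close>. The two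
  inequalities between these dimensions come from two linear maps. Let \<open>T\<close> be a basis of \<open>K\<close> over
  \<open>Z\<close>. If \<open>B\<close> is a left \<open>K\<close>-basis of \<open>S\<close>, then
  \<open>r \<mapsto> (\<Sum>\<^sub>x r\<^sub>x t x)\<^sub>t\<close> maps \<open>S\<^sup>B\<close> injectively into \<open>S\<^sup>T\<close>, since a kernel element would give a relation
  on \<open>B\<close> over the centralizer of \<open>K\<close>, which is \<open>K\<close>. If \<open>B'\<close> is a right \<open>K\<close>-basis of \<open>S\<close>, then
  \<open>s \<mapsto> (\<Sum>\<^sub>t s\<^sub>t x t)\<^sub>x\<close> maps \<open>S\<^sup>T\<close> injectively into \<open>S\<^bsup>B'\<^esup>\<close>, since a kernel element would give a
  relation on \<open>T\<close> over the centralizer of \<open>S\<close>, which is \<open>Z\<close>.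

  The consequence of interest is that \<open>|S|\<close> and \<open>|Z|\<close> determine \<open>d\<close>, hence \<open>|K|\<close>: all noncentral
  elements have centralizers of the same size.\<close>

lemma card_minimal_noncommutative:
  fixes S :: "'a :: division_ring set"
  assumes S: "division_subring S" "finite S"
    and minimal: "\<forall>T. division_subring T \<and> T \<subset> S \<longrightarrow> (\<forall>x\<in>T. \<forall>y\<in>T. x * y = y * x)"
    and a: "a \<in> S" "a \<notin> centralizer_in S S"
  obtains d where "d \<ge> 2" "card (centralizer_in S {a}) = card (centralizer_in S S) ^ d"
    "card S = card (centralizer_in S {a}) ^ d"
proof -
  define K where "K = centralizer_in S {a}"
  define Z where "Z = centralizer_in S S"
  have K: "division_subring K" and Z: "division_subring Z"
    unfolding K_def Z_def by (intro division_subring_centralizer S)+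
  have "K \<noteq> S"
  proof
    assume "K = S"
    then have "x * a = a * x" if "x \<in> S" for x using that unfolding K_def centralizer_in_def by blast
    then show False using a by (auto simp: centralizer_in_def)
  qed
  moreover have "K \<subseteq> S" and ZK: "Z \<subseteq> K" and aK: "a \<in> K"
    using a(1) by (auto simp: K_def Z_def centralizer_in_def)
  ultimately have KS: "K \<subseteq> S" "K \<noteq> S" by blast+
  have finK: "finite K" and finZ: "finite Z"
    using KS ZK S(2) by (meson finite_subset)+
  have comm: "x * y = y * x" if "x \<in> K" "y \<in> K" for x y
    using minimal K KS that by blast
  have CK: "centralizer_in S K = K"
  proof (intro equalityI subsetI)
    fix x assume "x \<in> centralizer_in S K"
    then have "x \<in> S" "x * a = a * x" using aK by (auto simp: centralizer_in_def)
    then show "x \<in> K" by (simp add: K_def centralizer_in_def)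
  next
    fix x assume "x \<in> K"
    then show "x \<in> centralizer_in S K" using comm KS(1) unfolding centralizer_in_def by blast
  qed
  note Sc = division_subringD[OF S(1)] and Kc = division_subringD[OF K]
  have Zcomm: "z * x = x * z" if "z \<in> Z" "x \<in> S" for z x
    using that by (auto simp: Z_def centralizer_in_def)
  obtain T where T: "T \<subseteq> K" "card K = card Z ^ card T"
    and T_span: "\<And>k. k \<in> K \<Longrightarrow> \<exists>c. (\<forall>t\<in>T. c t \<in> Z) \<and> k = (\<Sum>t\<in>T. c t * t)"
    and T_indep: "\<And>c. (\<And>t. t \<in> T \<Longrightarrow> c t \<in> Z) \<Longrightarrow> (\<Sum>t\<in>T. c t * t) = 0 \<Longrightarrow> \<forall>t\<in>T. c t = 0"
    by (rule exists_basis_of_action[OF Z finZ finK, of "(*)"])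
      (use Kc ZK in \<open>auto simp: algebra_simps\<close>)
  obtain B where B: "B \<subseteq> S" "card S = card K ^ card B"
    and B_indep: "\<And>c. (\<And>x. x \<in> B \<Longrightarrow> c x \<in> K) \<Longrightarrow> (\<Sum>x\<in>B. c x * x) = 0 \<Longrightarrow> \<forall>x\<in>B. c x = 0"
    by (rule exists_basis_of_action[OF K finK S(2), of "(*)"])
      (use Sc KS in \<open>auto simp: algebra_simps\<close>)
  obtain B' where B': "B' \<subseteq> S" "card S = card K ^ card B'"
    and B'_span: "\<And>y. y \<in> S \<Longrightarrow> \<exists>c. (\<forall>x\<in>B'. c x \<in> K) \<and> y = (\<Sum>x\<in>B'. x * c x)"
    by (rule exists_basis_of_action[OF K finK S(2), of "\<lambda>k x. x * k"])
      (use Sc KS comm in \<open>auto simp: algebra_simps\<close>)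
  have fin: "finite T" "finite B" "finite B'"
    using T B B' finK S(2) by (meson finite_subset)+
  have cardS: "card S \<ge> 2" and cardK: "card K \<ge> 2" and cardZ: "card Z \<ge> 2"
    using card_division_subring S K finK Z finZ by blast+
  have dim_eq: "card B' = card B"
    using B(2) B'(2) cardK by (metis power_inject_exp Suc_1 Suc_le_lessD)
  have le1: "card B \<le> card T"
  proof -
    have "inj_on (\<lambda>r. \<lambda>t\<in>T. \<Sum>x\<in>B. r x * t * x) (B \<rightarrow>\<^sub>E S)"
    proof (rule inj_onI, rule ccontr)
      fix r r' assume r: "r \<in> B \<rightarrow>\<^sub>E S" "r' \<in> B \<rightarrow>\<^sub>E S" and "r \<noteq> r'"
        and eq: "(\<lambda>t\<in>T. \<Sum>x\<in>B. r x * t * x) = (\<lambda>t\<in>T. \<Sum>x\<in>B. r' x * t * x)"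
      define u where "u x = r x - r' x" for x
      have u: "u x \<in> S" if "x \<in> B" for x using r that Sc(3) by (auto simp: u_def)
      have u_rel: "(\<Sum>x\<in>B. u x * t * x) = 0" if "t \<in> T" for t
        using fun_cong[OF eq, of t] that by (simp add: u_def algebra_simps sum_subtractf)
      \<comment> \<open>The relation extends from \<open>T\<close> to its \<open>Z\<close>-span because elements of \<open>Z\<close> move past \<open>u x\<close>.\<close>
      have rel: "(\<Sum>x\<in>B. u x * k * x) = 0" if k: "k \<in> K" for k
      proof -
        obtain c where c: "\<forall>t\<in>T. c t \<in> Z" "k = (\<Sum>t\<in>T. c t * t)" using T_span[OF k] by blast
        have "u x * (c t * t) * x = c t * (u x * t * x)" if "x \<in> B" "t \<in> T" for x t
          using Zcomm[of "c t" "u x"] c(1) that u by (metis mult.assoc)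
        then have "(\<Sum>x\<in>B. u x * k * x) = (\<Sum>x\<in>B. \<Sum>t\<in>T. c t * (u x * t * x))"
          unfolding c(2) sum_distrib_left sum_distrib_right by (intro sum.cong refl) auto
        also have "\<dots> = (\<Sum>t\<in>T. c t * (\<Sum>x\<in>B. u x * t * x))"
          by (subst sum.swap) (simp add: sum_distrib_left)
        finally show ?thesis using u_rel by simp
      qed
      have "\<exists>x\<in>B. u x \<noteq> 0"
        using \<open>r \<noteq> r'\<close> r by (auto simp: u_def intro: PiE_ext)
      from twisted_relation_yields_relation[OF S(1) K KS(1) fin(2) u rel this]
      show False using B_indep unfolding CK by blast
    qed
    moreover have "(\<lambda>r. \<lambda>t\<in>T. \<Sum>x\<in>B. r x * t * x) ` (B \<rightarrow>\<^sub>E S) \<subseteq> (T \<rightarrow>\<^sub>E S)"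
    proof (intro image_subsetI restrict_PiE_iff[THEN iffD2] ballI)
      fix r t assume "r \<in> B \<rightarrow>\<^sub>E S" "t \<in> T"
      then show "(\<Sum>x\<in>B. r x * t * x) \<in> S"
        by (intro division_subring_sum[OF S(1)] Sc(4)) (use T(1) B(1) KS(1) in auto)
    qed
    ultimately have "card (B \<rightarrow>\<^sub>E S) \<le> card (T \<rightarrow>\<^sub>E S)"
      using fin S(2) by (intro card_inj_on_le finite_PiE) auto
    then have "card S ^ card B \<le> card S ^ card T" using fin by (simp add: card_PiE)
    then show ?thesis using cardS by (simp add: power_increasing_iff)
  qed
  have le2: "card T \<le> card B'"
  proof -
    have "inj_on (\<lambda>s. \<lambda>x\<in>B'. \<Sum>t\<in>T. s t * x * t) (T \<rightarrow>\<^sub>E S)"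
    proof (rule inj_onI, rule ccontr)
      fix s s' assume s: "s \<in> T \<rightarrow>\<^sub>E S" "s' \<in> T \<rightarrow>\<^sub>E S" and "s \<noteq> s'"
        and eq: "(\<lambda>x\<in>B'. \<Sum>t\<in>T. s t * x * t) = (\<lambda>x\<in>B'. \<Sum>t\<in>T. s' t * x * t)"
      define u where "u t = s t - s' t" for t
      have u: "u t \<in> S" if "t \<in> T" for t using s that Sc(3) by (auto simp: u_def)
      have u_rel: "(\<Sum>t\<in>T. u t * x * t) = 0" if "x \<in> B'" for x
        using fun_cong[OF eq, of x] that by (simp add: u_def algebra_simps sum_subtractf)
      \<comment> \<open>The relation extends from \<open>B'\<close> to its right \<open>K\<close>-span because \<open>K\<close> is commutative.\<close>
      have rel: "(\<Sum>t\<in>T. u t * y * t) = 0" if y: "y \<in> S" for y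
      proof -
        obtain c where c: "\<forall>x\<in>B'. c x \<in> K" "y = (\<Sum>x\<in>B'. x * c x)" using B'_span[OF y] by blast
        have "u t * (x * c x) * t = u t * x * t * c x" if "x \<in> B'" "t \<in> T" for x t
          using comm[of "c x" t] c(1) that T(1) by (metis mult.assoc subsetD)
        then have "(\<Sum>t\<in>T. u t * y * t) = (\<Sum>t\<in>T. \<Sum>x\<in>B'. u t * x * t * c x)"
          unfolding c(2) sum_distrib_left sum_distrib_right by (intro sum.cong refl) auto
        also have "\<dots> = (\<Sum>x\<in>B'. (\<Sum>t\<in>T. u t * x * t) * c x)"
          by (subst sum.swap) (simp add: sum_distrib_right)
        finally show ?thesis using u_rel by simp
      qed
      have "\<exists>t\<in>T. u t \<noteq> 0"
        using \<open>s \<noteq> s'\<close> s by (auto simp: u_def intro: PiE_ext)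
      from twisted_relation_yields_relation[OF S(1) S(1) subset_refl fin(1) u rel this]
      show False using T_indep unfolding Z_def by blast
    qed
    moreover have "(\<lambda>s. \<lambda>x\<in>B'. \<Sum>t\<in>T. s t * x * t) ` (T \<rightarrow>\<^sub>E S) \<subseteq> (B' \<rightarrow>\<^sub>E S)"
    proof (intro image_subsetI restrict_PiE_iff[THEN iffD2] ballI)
      fix s x assume "s \<in> T \<rightarrow>\<^sub>E S" "x \<in> B'"
      then show "(\<Sum>t\<in>T. s t * x * t) \<in> S"
        by (intro division_subring_sum[OF S(1)] Sc(4)) (use T(1) B'(1) KS(1) in auto)
    qed
    ultimately have "card (T \<rightarrow>\<^sub>E S) \<le> card (B' \<rightarrow>\<^sub>E S)"
      using fin S(2) by (intro card_inj_on_le finite_PiE) auto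
    then have "card S ^ card T \<le> card S ^ card B'" using fin by (simp add: card_PiE)
    then show ?thesis using cardS by (simp add: power_increasing_iff)
  qed
  have d: "card B = card T" using le1 le2 dim_eq by simp
  have "card T \<noteq> 0" using T(2) cardK by (intro notI) simp
  moreover have "card T \<noteq> 1"
  proof
    assume "card T = 1"
    then have "card S = card K" using B(2) d by simp
    then show False using card_subset_eq[OF S(2) KS(1)] KS(2) by simp
  qed
  ultimately have "card T \<ge> 2" by linarith
  from that[OF this T(2)[unfolded K_def Z_def] B(2)[unfolded d K_def]] show thesis .
qed

text \<open>The fibers of \<open>g \<mapsto> g a g\<^bsup>-1\<^esup>\<close> on the nonzero elements are the left cosets of the unit group of
  the centralizer.\<close>

lemma card_conjugacy_class:
  fixes S :: "'a :: division_ring set"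
  assumes S: "division_subring S" "finite S" and a: "a \<in> S"
  shows "card ((\<lambda>g. g * a * inverse g) ` (S - {0})) * (card (centralizer_in S {a}) - 1) = card S - 1"
proof -
  define K where "K = centralizer_in S {a}"
  define conj where "conj g = g * a * inverse g" for g
  note Sc = division_subringD[OF S(1)]
  have K: "division_subring K" unfolding K_def by (intro division_subring_centralizer S)
  have fiber: "card {g \<in> S - {0}. conj g = y} = card K - 1" if y: "y \<in> conj ` (S - {0})" for y
  proof -
    obtain h where h: "h \<in> S" "h \<noteq> 0" "y = conj h" using y by blast
    have "bij_betw (\<lambda>k. h * k) (K - {0}) {g \<in> S - {0}. conj g = y}"
    proof (rule bij_betwI[where g = "\<lambda>g. inverse h * g"])
      show "(\<lambda>k. h * k) \<in> (K - {0}) \<rightarrow> {g \<in> S - {0}. conj g = y}"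
      proof
        fix k assume k: "k \<in> K - {0}"
        then have "k * a = a * k" "k \<in> S" by (auto simp: K_def centralizer_in_def)
        then have "h * k * a * (inverse k * inverse h) = h * a * (k * inverse k) * inverse h"
          by (metis mult.assoc)
        then have "conj (h * k) = y"
          using k h by (simp add: conj_def nonzero_inverse_mult_distrib)
        then show "h * k \<in> {g \<in> S - {0}. conj g = y}" using k h Sc(4) \<open>k \<in> S\<close> by auto
      qed
      show "(\<lambda>g. inverse h * g) \<in> {g \<in> S - {0}. conj g = y} \<rightarrow> (K - {0})"
      proof
        fix g assume g: "g \<in> {g \<in> S - {0}. conj g = y}"
        then have "g * a * inverse g = h * a * inverse h" using h by (simp add: conj_def)
        then have "inverse h * (g * a * inverse g) * g = inverse h * (h * a * inverse h) * g" by simp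
        moreover have "inverse h * (g * a * inverse g) * g = inverse h * g * a"
          using g by (simp add: mult.assoc)
        moreover have "inverse h * (h * a * inverse h) * g = a * (inverse h * g)"
          using h by (simp add: mult.assoc[symmetric])
        ultimately show "inverse h * g \<in> K - {0}"
          using g h Sc(4,5) by (auto simp: K_def centralizer_in_def)
      qed
    qed (use h in \<open>auto simp: mult.assoc[symmetric]\<close>)
    then have "card (K - {0}) = card {g \<in> S - {0}. conj g = y}" by (rule bij_betw_same_card)
    then show ?thesis using division_subringD(2)[OF K] by (simp add: card_Diff_singleton)
  qed
  have "card S - 1 = (\<Sum>g\<in>S - {0}. 1)"
    using Sc(2) by (simp add: card_Diff_singleton)
  also have "\<dots> = (\<Sum>y\<in>conj ` (S - {0}). \<Sum>g\<in>{g \<in> S - {0}. conj g = y}. 1)"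
    by (rule sum.image_gen) (use S in auto)
  also have "\<dots> = (\<Sum>y\<in>conj ` (S - {0}). card K - 1)"
    by (rule sum.cong) (use fiber in auto)
  finally show ?thesis by (simp add: conj_def K_def)
qed

text \<open>A minimal counterexample is refuted by its class equation. All noncentral elements have
  centralizers of the same size \<open>k = q\<^sup>d\<close>, where \<open>q\<close> is the size of the center and \<open>d \<ge> 2\<close>, so all
  their conjugacy classes have the same size \<open>c = (k\<^sup>d - 1) / (k - 1)\<close>. As these classes partition
  the noncentral elements, \<open>c\<close> divides \<open>k\<^sup>d - q\<close> as well as \<open>k\<^sup>d - 1\<close>, hence \<open>q - 1\<close>. But
  \<open>c \<ge> k + 1 > q - 1\<close>. Because the classes have equal size, cyclotomic polynomials can be
  avoided.\<close>

lemma finite_division_subring_commutative: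
  fixes S :: "'a :: division_ring set"
  assumes "division_subring S" "finite S" "x \<in> S" "y \<in> S"
  shows "x * y = y * x"
  using assms
proof (induction "card S" arbitrary: S x y rule: less_induct)
  case less
  note S = less.prems(1,2) and Sc = division_subringD[OF less.prems(1)]
  have minimal: "\<forall>T. division_subring T \<and> T \<subset> S \<longrightarrow> (\<forall>x\<in>T. \<forall>y\<in>T. x * y = y * x)"
    using less.hyps psubset_card_mono[OF S(2)] finite_subset[OF _ S(2)] by blast
  define Z where "Z = centralizer_in S S"
  have Z: "division_subring Z" unfolding Z_def by (intro division_subring_centralizer S)
  have ZS: "Z \<subseteq> S" and finZ: "finite Z"
    using S(2) by (auto simp: Z_def centralizer_in_def)
  have q: "card Z \<ge> 2" using card_division_subring Z finZ by blast
  define cl where "cl a = (\<lambda>g. g * a * inverse g) ` (S - {0})" for a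
  show ?case
  proof (rule ccontr)
    assume "x * y \<noteq> y * x"
    then have x: "x \<in> S - Z" using less.prems(3,4) by (auto simp: Z_def centralizer_in_def)
    obtain d where d: "d \<ge> 2" "card (centralizer_in S {x}) = card Z ^ d"
      "card S = card (centralizer_in S {x}) ^ d"
      using card_minimal_noncommutative[OF S minimal, of x] x unfolding Z_def by blast
    define k where "k = card Z ^ d"
    have k: "k \<ge> 2" "k > card Z - 1"
    proof -
      have "card Z ^ 1 \<le> k" unfolding k_def by (rule power_increasing) (use d q in auto)
      then show "k \<ge> 2" "k > card Z - 1" using q by auto
    qed
    have cardS: "card S = k ^ d" using d by (simp add: k_def)
    have same: "card (centralizer_in S {a}) = k" if a: "a \<in> S - Z" for a
    proof -
      obtain e where e: "e \<ge> 2" "card (centralizer_in S {a}) = card Z ^ e"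
        "card S = card (centralizer_in S {a}) ^ e"
        using card_minimal_noncommutative[OF S minimal, of a] a unfolding Z_def by blast
      have "card Z ^ (d * d) = card Z ^ (e * e)"
        using d e by (simp add: power_mult)
      then have "d * d = e * e" using q by simp
      then have "d = e" by (metis power2_eq_square power2_eq_iff_nonneg le0)
      then show ?thesis using e by (simp add: k_def)
    qed
    have class_size: "card (cl a) * (k - 1) = card S - 1" if "a \<in> S - Z" for a
      using card_conjugacy_class[OF S, of a] same[OF that] that by (simp add: cl_def)
    define c where "c = card (cl x)"
    have class_card: "card (cl a) = c" if "a \<in> S - Z" for a
      using class_size[OF that] class_size[OF x] k by (metis c_def mult_cancel2 diff_is_0_eq not_less_eq_eq numeral_2_eq_2 One_nat_def)
    have refl: "a \<in> cl a" if "a \<in> S" for a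
      unfolding cl_def by (rule image_eqI[of _ _ 1]) (use Sc(1) in auto)
    have cl_eq: "cl b = cl a" if b: "b \<in> cl a" for a b
    proof -
      obtain g where g: "g \<in> S" "g \<noteq> 0" "b = g * a * inverse g" using b by (auto simp: cl_def)
      have "h * b * inverse h \<in> cl a" if "h \<in> S" "h \<noteq> 0" for h
        unfolding cl_def
        by (rule image_eqI[of _ _ "h * g"])
          (use that g Sc(4) in \<open>auto simp: nonzero_inverse_mult_distrib mult.assoc\<close>)
      moreover have "h * a * inverse h \<in> cl b" if "h \<in> S" "h \<noteq> 0" for h
        unfolding cl_def
      proof (rule image_eqI[of _ _ "h * inverse g"])
        have "h * inverse g * b * inverse (h * inverse g)
            = h * (inverse g * g) * a * (inverse g * g) * inverse h"
          using that g(2) by (simp only: g(3) nonzero_inverse_mult_distrib nonzero_inverse_inverse_eq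
              inverse_nonzero_iff_nonzero mult.assoc simp_thms)
        then show "h * a * inverse h = h * inverse g * b * inverse (h * inverse g)"
          using g by simp
      qed (use that g Sc(4,5) in auto)
      ultimately show ?thesis by (auto simp: cl_def[of a] cl_def[of b])
    qed
    have cl_sub: "cl a \<subseteq> S - Z" if a: "a \<in> S - Z" for a
    proof
      fix b assume b: "b \<in> cl a"
      have "b \<in> S" using b a Sc(4,5) by (auto simp: cl_def)
      moreover have "b \<notin> Z"
      proof
        assume "b \<in> Z"
        then have "g * b * inverse g = b" if "g \<in> S" "g \<noteq> 0" for g
          using that by (auto simp: Z_def centralizer_in_def mult.assoc)
            (metis mult.assoc mult.right_neutral right_inverse)
        then have "cl b \<subseteq> {b}" by (auto simp: cl_def)
        moreover have "a \<in> cl b" using cl_eq[OF b] refl a by auto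
        ultimately show False using a \<open>b \<in> Z\<close> by auto
      qed
      ultimately show "b \<in> S - Z" by blast
    qed
    have Un: "\<Union> (cl ` (S - Z)) = S - Z" using cl_sub refl by blast
    have "c * card (cl ` (S - Z)) = card (\<Union> (cl ` (S - Z)))"
    proof (rule card_partition)
      show "C \<inter> C' = {}" if "C \<in> cl ` (S - Z)" "C' \<in> cl ` (S - Z)" "C \<noteq> C'" for C C'
        using that cl_eq by blast
    qed (use S(2) class_card in \<open>auto simp: Un cl_def\<close>)
    also have "\<dots> = card S - card Z" unfolding Un by (rule card_Diff_subset[OF finZ ZS])
    finally have "c dvd card S - card Z" by (metis dvd_triv_left)
    moreover have "c dvd card S - 1" using class_size[OF x] by (metis c_def dvd_triv_left)
    ultimately have "c dvd (card S - 1) - (card S - card Z)" by (metis dvd_diff_nat)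
    moreover have "(card S - 1) - (card S - card Z) = card Z - 1"
      using card_mono[OF S(2) ZS] q by linarith
    ultimately have "c dvd card Z - 1" by simp
    then have "c \<le> card Z - 1" using q by (intro dvd_imp_le) auto
    moreover have "k < c"
    proof -
      have "k ^ 2 \<le> card S" unfolding cardS by (rule power_increasing) (use d k in auto)
      obtain k' where k': "k = Suc k'" "k' \<ge> 1" using k by (cases k) auto
      have "(k + 1) * (k - 1) \<le> c * (k - 1)"
        using class_size[OF x] \<open>k ^ 2 \<le> card S\<close> k' by (simp add: c_def power2_eq_square)
      then have "k + 1 \<le> c" using k(1) unfolding mult_le_cancel2 by linarith
      then show ?thesis by simp
    qed
    ultimately show False using k by linarith
  qed
qed

lemma wedderburn_little:
  assumes "finite (UNIV :: 'a :: division_ring set)"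
  shows "(x :: 'a) * y = y * x"
  using finite_division_subring_commutative[OF division_subring_UNIV assms] by simp

text \<open>This is where the dimension being greater than \<open>1\<close> enters: over a finite center the whole ring
  would be finite, hence commutative, hence equal to its center and of dimension \<open>1\<close>.\<close>

lemma infinite_center:
  fixes v :: "'m :: finite \<Rightarrow> 'a :: division_ring"
  assumes "card (UNIV :: 'm set) > 1" and v: "center_basis v"
  shows "infinite (UNIV :: 'a center set)"
proof
  assume fin: "finite (UNIV :: 'a center set)"
  have "finite (center.span (range v))"
  proof -
    have "finite (range v \<rightarrow>\<^sub>E (UNIV :: 'a center set))" using fin by (intro finite_PiE) auto
    moreover have "center.span (range v) \<subseteq>
      (\<lambda>c. \<Sum>y\<in>range v. center_scale (c y) y) ` (range v \<rightarrow>\<^sub>E UNIV)"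
    proof
      fix x assume "x \<in> center.span (range v)"
      then obtain c where "x = (\<Sum>y\<in>range v. center_scale (c y) y)"
        by (auto simp: center.span_finite)
      then show "x \<in> (\<lambda>c. \<Sum>y\<in>range v. center_scale (c y) y) ` (range v \<rightarrow>\<^sub>E UNIV)"
        by (intro image_eqI[of _ _ "restrict c (range v)"]) auto
    qed
    ultimately show ?thesis using finite_surj by blast
  qed
  then have "finite (UNIV :: 'a set)" using v by (simp add: center_basis_def)
  then have comm: "x * y = y * x" for x y :: 'a by (rule wedderburn_little)
  obtain s t :: 'm where "s \<noteq> t"
    using assms(1) by (metis card_le_Suc0_iff_eq finite_class.finite_UNIV One_nat_def not_less UNIV_I)
  have indep: "center.independent (range v)" and "v s \<noteq> v t"
    using v \<open>s \<noteq> t\<close> by (auto simp: center_basis_def inj_def)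
  have "v s \<noteq> 0" using indep center.dependent_zero by (metis rangeI)
  have of_Abs: "of_center (Abs_center z) = z" for z :: 'a
    using comm by (intro Abs_center_inverse) blast
  have "v t = center_scale (Abs_center (v t * inverse (v s))) (v s)"
    using \<open>v s \<noteq> 0\<close> by (simp add: center_scale_def of_Abs mult.assoc)
  then have "v t \<in> center.span (range v - {v t})"
    using \<open>v s \<noteq> v t\<close> by (metis DiffI center.span_base center.span_scale rangeI singletonD)
  then show False using indep by (auto simp: center.dependent_def)
qed

section \<open>Evaluation of central polynomials\<close>

text \<open>The monomial functions \<open>c \<mapsto> c\<^sup>I\<close> are homomorphisms in \<open>c\<close> and in \<open>I\<close>; the first fact makes them
  multiplicative characters of \<open>F\<^sup>k\<close>, the second makes evaluation multiplicative.\<close>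

definition eval_monom :: "('k :: finite \<Rightarrow> 'b :: comm_monoid_mult) \<Rightarrow> ('k \<Rightarrow>\<^sub>0 nat) \<Rightarrow> 'b"
  where "eval_monom c I = (\<Prod>p\<in>UNIV. c p ^ Poly_Mapping.lookup I p)"

lemma eval_monom_zero [simp]: "eval_monom c 0 = 1"
  by (simp add: eval_monom_def)

lemma eval_monom_add: "eval_monom c (I + J) = eval_monom c I * eval_monom c J"
  by (simp add: eval_monom_def lookup_add power_add prod.distrib)

lemma eval_monom_mult: "eval_monom (\<lambda>p. c p * d p) I = eval_monom c I * eval_monom d I"
  by (simp add: eval_monom_def power_mult_distrib prod.distrib)

lemma eval_monom_one [simp]: "eval_monom (\<lambda>p. 1) I = 1"
  by (simp add: eval_monom_def)

lemma eval_monom_single: "eval_monom c (Poly_Mapping.single p n) = c p ^ n"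
proof -
  have "eval_monom c (Poly_Mapping.single p n) = (\<Prod>q\<in>UNIV. if q = p then c p ^ n else 1)"
    unfolding eval_monom_def by (rule prod.cong) (auto simp: lookup_single)
  then show ?thesis by simp
qed

lemma eval_monom_update_one: "eval_monom ((\<lambda>_. 1)(p := t)) I = t ^ Poly_Mapping.lookup I p"
proof -
  have "eval_monom ((\<lambda>_. 1)(p := t)) I
      = (\<Prod>q\<in>UNIV. if q = p then t ^ Poly_Mapping.lookup I p else 1)"
    unfolding eval_monom_def by (rule prod.cong) auto
  then show ?thesis by simp
qed

lemma of_center_simps [simp]:
  "of_center 0 = 0" "of_center 1 = 1" "of_center (x + y) = of_center x + of_center y"
  "of_center (x - y) = of_center x - of_center y" "of_center (x * y) = of_center x * of_center y"
  by (simp_all add: zero_center.rep_eq one_center.rep_eq plus_center.rep_eq minus_center.rep_eq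
      times_center.rep_eq)

lemma of_center_commute: "of_center z * x = x * of_center z"
  using of_center[of z] by simp

lemma central_eval_superset:
  assumes "finite M" "Poly_Mapping.keys g \<subseteq> M"
  shows "central_eval g c = (\<Sum>I\<in>M. Poly_Mapping.lookup g I * of_center (eval_monom c I))"
  unfolding central_eval_def eval_monom_def
  by (rule sum.mono_neutral_left) (use assms in \<open>auto simp: in_keys_iff\<close>)

lemma central_eval_add: "central_eval (f + g) c = central_eval f c + central_eval g c"
proof -
  let ?M = "Poly_Mapping.keys f \<union> Poly_Mapping.keys g"
  have "Poly_Mapping.keys (f + g) \<subseteq> ?M" by (rule keys_add)
  then show ?thesis
    by (simp add: central_eval_superset[of ?M] lookup_add distrib_right sum.distrib)
qed

lemma central_eval_single: "central_eval (Poly_Mapping.single I d) c = d * of_center (eval_monom c I)"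
  by (subst central_eval_superset[of "{I}"]) auto

lemma central_eval_zero [simp]: "central_eval 0 c = 0"
  by (simp add: central_eval_def)

lemma poly_mapping_single_induct [case_names single add]:
  fixes g :: "'k \<Rightarrow>\<^sub>0 'b :: comm_monoid_add"
  assumes single: "\<And>I d. P (Poly_Mapping.single I d)"
    and add: "\<And>f g. P f \<Longrightarrow> P g \<Longrightarrow> P (f + g)"
  shows "P g"
proof -
  have "P 0" using single[of undefined 0] by simp
  then have "P (\<Sum>I\<in>M. Poly_Mapping.single I (Poly_Mapping.lookup g I))" for M
    by (induction M rule: infinite_finite_induct) (auto intro: single add)
  moreover have "g = (\<Sum>I\<in>Poly_Mapping.keys g. Poly_Mapping.single I (Poly_Mapping.lookup g I))"
    by (rule poly_mapping_eqI)
      (auto simp: lookup_sum lookup_single when_def in_keys_iff)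
  ultimately show ?thesis by metis
qed

text \<open>Evaluation is multiplicative only because the values of the variables are central: they can be
  moved past the coefficients of the second factor.\<close>

lemma central_eval_mult:
  fixes f g :: "('a :: division_ring, 'k :: finite) central_poly"
  shows "central_eval (f * g) c = central_eval f c * central_eval g c"
proof (induction f rule: poly_mapping_single_induct)
  case (single I d)
  show ?case
  proof (induction g rule: poly_mapping_single_induct)
    case (single J e)
    have "d * e * (of_center (eval_monom c I) * of_center (eval_monom c J))
        = d * of_center (eval_monom c I) * (e * of_center (eval_monom c J))"
      by (metis mult.assoc of_center_commute)
    then show ?case by (simp add: mult_single central_eval_single eval_monom_add)
  qed (simp add: distrib_left central_eval_add)
qed (simp add: distrib_right central_eval_add)

lemma central_eval_const [simp]: "central_eval (central_const d) c = d"
  by (simp add: central_const_def central_eval_single)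

lemma central_eval_var [simp]: "central_eval (central_var p) c = of_center (c p)"
  by (simp add: central_var_def central_eval_single eval_monom_single)

lemma central_const_one: "central_const 1 = 1"
  by (simp add: central_const_def)

text \<open>Constants and variables generate the ring of central polynomials, so two homomorphisms that agree
  on them are equal; this gives the uniqueness of the isomorphism.\<close>

lemma central_poly_generated [case_names const var add mult]:
  fixes g :: "('a :: division_ring, 'k) central_poly"
  assumes const: "\<And>d. Q (central_const d)" and var: "\<And>p. Q (central_var p)"
    and add: "\<And>f g. Q f \<Longrightarrow> Q g \<Longrightarrow> Q (f + g)" and mult: "\<And>f g. Q f \<Longrightarrow> Q g \<Longrightarrow> Q (f * g)"
  shows "Q g"
proof (induction g rule: poly_mapping_single_induct)
  case (single I d)
  have "Q (Poly_Mapping.single I 1)"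
  proof (induction I rule: poly_mapping_single_induct)
    case (single p n)
    show ?case
    proof (induction n)
      case 0
      show ?case using const[of 1] by (simp add: central_const_def)
    next
      case (Suc n)
      then show ?case
        using mult[OF var[of p] Suc] by (simp add: central_var_def mult_single single_add[symmetric])
    qed
  next
    case (add I J)
    then show ?case using mult[OF add] by (simp add: mult_single)
  qed
  then have "Q (central_const d * Poly_Mapping.single I 1)" by (rule mult[OF const])
  then show ?case by (simp add: central_const_def mult_single)
qed (rule add)

text \<open>Varying a single coordinate in which the exponents \<open>m \<noteq> n\<close> differ reduces the claim to the fact
  that \<open>t\<^sup>m - t\<^sup>n\<close> has only finitely many roots.\<close>

lemma eval_monom_separates:
  fixes I J :: "'k :: finite \<Rightarrow>\<^sub>0 nat"
  assumes "infinite (UNIV :: 'b :: field set)" "I \<noteq> J"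
  obtains u :: "'k \<Rightarrow> 'b :: field" where "eval_monom u I \<noteq> eval_monom u J"
proof -
  obtain p where p: "Poly_Mapping.lookup I p \<noteq> Poly_Mapping.lookup J p"
    using assms(2) by (meson poly_mapping_eqI)
  let ?q = "monom 1 (Poly_Mapping.lookup I p) - monom 1 (Poly_Mapping.lookup J p) :: 'b poly"
  have "coeff ?q (Poly_Mapping.lookup I p) = 1" using p by simp
  then have "?q \<noteq> 0" by force
  then have "finite {t. poly ?q t = 0}" by (rule poly_roots_finite)
  then obtain t where "poly ?q t \<noteq> 0" using ex_new_if_finite[OF assms(1)] by blast
  then show thesis
    using that[of "(\<lambda>_. 1)(p := t)"] by (simp add: eval_monom_update_one poly_monom)
qed

text \<open>Dedekind's independence of characters, with coefficients in the division ring. The argument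
  survives noncommutativity since the characters take central values. It shows that central
  polynomials over a ring with infinite center are determined by their values.\<close>

lemma eval_monom_independent:
  fixes a :: "('k :: finite \<Rightarrow>\<^sub>0 nat) \<Rightarrow> 'a :: division_ring"
  assumes inf: "infinite (UNIV :: 'a center set)"
    and "finite M" "\<And>c. (\<Sum>I\<in>M. a I * of_center (eval_monom c I)) = 0"
  shows "\<forall>I\<in>M. a I = 0"
  using assms(2,3)
proof (induction M arbitrary: a rule: finite_induct)
  case (insert J M)
  have "a I = 0" if I: "I \<in> M" for I
  proof -
    obtain u where u: "eval_monom u I \<noteq> (eval_monom u J :: 'a center)"
      using eval_monom_separates[OF inf] insert.hyps(2) I by metis
    \<comment> \<open>Evaluating at \<open>u * c\<close> and at \<open>c\<close> and eliminating the \<open>J\<close>-term.\<close>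
    have "(\<Sum>H\<in>M. a H * of_center (eval_monom u H - eval_monom u J) * of_center (eval_monom c H)) = 0"
      for c
    proof -
      have "0 = (\<Sum>H\<in>insert J M. a H * of_center (eval_monom (\<lambda>p. u p * c p) H))
          - (\<Sum>H\<in>insert J M. a H * of_center (eval_monom c H)) * of_center (eval_monom u J)"
        by (simp add: insert.prems del: sum.insert)
      also have "\<dots> = (\<Sum>H\<in>insert J M.
          a H * of_center (eval_monom u H - eval_monom u J) * of_center (eval_monom c H))"
        unfolding sum_distrib_right sum_subtractf[symmetric]
      proof (rule sum.cong[OF refl])
        fix H
        have "a H * of_center (eval_monom c H) * of_center (eval_monom u J)
            = a H * of_center (eval_monom u J) * of_center (eval_monom c H)"
          by (metis mult.assoc of_center_commute)
        then show "a H * of_center (eval_monom (\<lambda>p. u p * c p) H)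
              - a H * of_center (eval_monom c H) * of_center (eval_monom u J)
            = a H * of_center (eval_monom u H - eval_monom u J) * of_center (eval_monom c H)"
          by (simp only: eval_monom_mult of_center_simps left_diff_distrib right_diff_distrib mult.assoc)
      qed
      finally show ?thesis using insert.hyps by simp
    qed
    from insert.IH[OF this] have "a I * of_center (eval_monom u I - eval_monom u J) = 0"
      using I by blast
    moreover have "of_center (eval_monom u I - eval_monom u J) \<noteq> 0"
      using u by (metis of_center_simps(1) of_center_inject right_minus_eq)
    ultimately show ?thesis by simp
  qed
  moreover from this have "a J = 0"
    using insert.prems[of "\<lambda>_. 1"] insert.hyps by simp
  ultimately show ?case by simp
qed simp

lemma central_eval_eq_imp_eq:
  fixes f g :: "('a :: division_ring, 'k :: finite) central_poly"
  assumes inf: "infinite (UNIV :: 'a center set)" and eq: "\<And>c. central_eval f c = central_eval g c"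
  shows "f = g"
proof -
  let ?M = "Poly_Mapping.keys f \<union> Poly_Mapping.keys g"
  have "\<forall>I\<in>?M. Poly_Mapping.lookup f I - Poly_Mapping.lookup g I = 0"
    by (rule eval_monom_independent[OF inf])
      (use eq in \<open>auto simp: central_eval_superset[of ?M] left_diff_distrib sum_subtractf\<close>)
  then show ?thesis by (intro poly_mapping_eqI) (metis Un_iff eq_iff_diff_eq_0 not_in_keys_iff_lookup_eq_zero)
qed

section \<open>The ring of polynomial functions\<close>

text \<open>The last coefficient of the first monomial is merged with the first coefficient of the second
  one, so that coefficients and variables still alternate.\<close>

fun gen_monom_mult :: "('a \<times> 'n) list \<times> 'a \<Rightarrow> ('a \<times> 'n) list \<times> 'a \<Rightarrow> ('a :: division_ring \<times> 'n) list \<times> 'a"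
  where
    "gen_monom_mult (w, d) ([], e) = (w, d * e)"
  | "gen_monom_mult (w, d) ((a, \<mu>) # w', e) = (w @ (d * a, \<mu>) # w', e)"

lemma gen_monom_eval_mult:
  "gen_monom_eval (gen_monom_mult u w) x = gen_monom_eval u x * gen_monom_eval w x"
  by (induction u w rule: gen_monom_mult.induct) (simp_all add: gen_monom_eval_def mult.assoc)

lemma sum_list_mult_sum_list:
  fixes f :: "'b \<Rightarrow> 'a :: semiring_0"
  shows "(\<Sum>x\<leftarrow>xs. f x) * (\<Sum>y\<leftarrow>ys. g y) = (\<Sum>(x, y)\<leftarrow>List.product xs ys. f x * g y)"
  by (induction xs) (simp_all add: distrib_right sum_list_const_mult o_def)

lemma poly_funs_const: "(\<lambda>x. d) \<in> poly_funs"
  unfolding poly_funs_def by (auto simp: gen_monom_eval_def intro!: exI[of _ "[([], d)]"])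

lemma poly_funs_proj: "(\<lambda>x. x i) \<in> poly_funs"
  unfolding poly_funs_def by (auto simp: gen_monom_eval_def intro!: exI[of _ "[([(1, i)], 1)]"])

lemma poly_funs_add:
  assumes "f \<in> poly_funs" "g \<in> poly_funs"
  shows "(\<lambda>x. f x + g x) \<in> poly_funs"
proof -
  obtain us ws where "f = (\<lambda>x. \<Sum>w\<leftarrow>us. gen_monom_eval w x)" "g = (\<lambda>x. \<Sum>w\<leftarrow>ws. gen_monom_eval w x)"
    using assms by (auto simp: poly_funs_def)
  then show ?thesis unfolding poly_funs_def by (auto intro!: exI[of _ "us @ ws"])
qed

lemma poly_funs_mult:
  assumes "f \<in> poly_funs" "g \<in> poly_funs"
  shows "(\<lambda>x. f x * g x) \<in> poly_funs"
proof -
  obtain us ws where "f = (\<lambda>x. \<Sum>w\<leftarrow>us. gen_monom_eval w x)" "g = (\<lambda>x. \<Sum>w\<leftarrow>ws. gen_monom_eval w x)"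
    using assms by (auto simp: poly_funs_def)
  then have "(\<lambda>x. f x * g x)
      = (\<lambda>x. \<Sum>w\<leftarrow>map (\<lambda>(u, w). gen_monom_mult u w) (List.product us ws). gen_monom_eval w x)"
    by (simp add: sum_list_mult_sum_list gen_monom_eval_mult o_def case_prod_unfold)
  then show ?thesis unfolding poly_funs_def by blast
qed

lemma poly_funs_sum:
  assumes "\<And>i. i \<in> I \<Longrightarrow> f i \<in> poly_funs"
  shows "(\<lambda>x. \<Sum>i\<in>I. f i x) \<in> poly_funs"
  using assms
  by (induction I rule: infinite_finite_induct) (simp_all add: poly_funs_const poly_funs_add)

lemma coord_fun_in_poly_funs: "coord_fun v b i j \<in> poly_funs"
  unfolding coord_fun_def center_scale_def
  by (intro poly_funs_sum poly_funs_mult poly_funs_const poly_funs_proj)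

text \<open>Polynomial functions are generated by the constants and the coordinate projections, which
  reduces inclusions of \<open>poly_funs\<close> in a ring to these generators.\<close>

lemma poly_funs_generated [consumes 1, case_names const proj add mult]:
  assumes "f \<in> poly_funs"
    and const: "\<And>d. Q (\<lambda>x. d)" and proj: "\<And>i. Q (\<lambda>x. x i)"
    and add: "\<And>f g. Q f \<Longrightarrow> Q g \<Longrightarrow> Q (\<lambda>x. f x + g x)"
    and mult: "\<And>f g. Q f \<Longrightarrow> Q g \<Longrightarrow> Q (\<lambda>x. f x * g x)"
  shows "Q f"
proof -
  obtain ws where f: "f = (\<lambda>x. \<Sum>w\<leftarrow>ws. gen_monom_eval w x)"
    using assms(1) by (auto simp: poly_funs_def)
  have monom: "Q (gen_monom_eval (w, d))" for w d
  proof (induction w)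
    case Nil
    show ?case using const[of d] by (simp add: gen_monom_eval_def[abs_def])
  next
    case (Cons am w)
    obtain a \<mu> where am: "am = (a, \<mu>)" by force
    show ?case
      using mult[OF mult[OF const[of a] proj[of \<mu>]] Cons]
      by (simp add: gen_monom_eval_def[abs_def] am mult.assoc)
  qed
  have "Q (\<lambda>x. \<Sum>w\<leftarrow>ws. gen_monom_eval w x)"
  proof (induction ws)
    case Nil
    show ?case using const[of 0] by simp
  next
    case (Cons w ws)
    obtain u d where "w = (u, d)" by force
    then show ?case using add[OF monom[of u d] Cons] by simp
  qed
  then show ?thesis by (simp add: f)
qed

section \<open>Polynomial functions as central polynomials in coordinates\<close>

text \<open>The second assumption is the coordinate formula defining the constants \<open>b\<close>: it makes each
  coordinate a two-sided linear expression in the element. It also makes coordinates unique.\<close>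

locale center_coordinates =
  fixes v :: "'m :: finite \<Rightarrow> 'a :: division_ring"
    and b :: "'m \<Rightarrow> 'm \<Rightarrow> 'm \<Rightarrow> 'a center"
  assumes basis: "center_basis v"
    and coordinate: "\<And>c i. of_center (c i) = (\<Sum>s\<in>UNIV. \<Sum>t\<in>UNIV.
      center_scale (b i s t) (v s * (\<Sum>k\<in>UNIV. center_scale (c k) (v k)) * v t))"
begin

definition coords :: "'a \<Rightarrow> 'm \<Rightarrow> 'a center"
  where "coords x = (SOME c. x = (\<Sum>k\<in>UNIV. center_scale (c k) (v k)))"

lemma coords_expansion: "(\<Sum>k\<in>UNIV. center_scale (coords x k) (v k)) = x"
proof -
  have "inj v" "x \<in> center.span (range v)" using basis by (auto simp: center_basis_def)
  then obtain c where "x = (\<Sum>y\<in>range v. center_scale (c y) y)"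
    by (auto simp: center.span_finite)
  also have "\<dots> = (\<Sum>k\<in>UNIV. center_scale ((c \<circ> v) k) (v k))"
    using \<open>inj v\<close> by (simp add: sum.reindex)
  finally have "x = (\<Sum>k\<in>UNIV. center_scale (coords x k) (v k))"
    unfolding coords_def by (rule someI[where P = "\<lambda>c. x = (\<Sum>k\<in>UNIV. center_scale (c k) (v k))"])
  then show ?thesis ..
qed

lemma of_center_coords: "of_center (coords (x i) j) = coord_fun v b i j x"
  unfolding coord_fun_def by (subst coordinate) (simp add: coords_expansion)

lemma coords_combination: "coords (\<Sum>k\<in>UNIV. center_scale (c k) (v k)) = c"
proof
  fix j
  let ?x = "\<Sum>k\<in>UNIV. center_scale (c k) (v k)"
  have "of_center (coords ?x j) = of_center (c j)"
    by (subst (1 2) coordinate) (simp add: coords_expansion)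
  then show "coords ?x j = c j" by (simp add: of_center_inject)
qed

text \<open>The inverse of the isomorphism: substitute for \<open>y\<^sub>i\<^sub>j\<close> the \<open>j\<close>-th coordinate of \<open>x\<^sub>i\<close>. In this
  direction the map is given by a formula and is visibly a ring homomorphism.\<close>

definition poly_fun_of :: "('a, 'n \<times> 'm) central_poly \<Rightarrow> ('n :: finite \<Rightarrow> 'a) \<Rightarrow> 'a"
  where "poly_fun_of g = (\<lambda>x. central_eval g (\<lambda>(i, j). coords (x i) j))"

lemma poly_fun_of_simps:
  "poly_fun_of (f + g) = (\<lambda>x. poly_fun_of f x + poly_fun_of g x)"
  "poly_fun_of (f * g) = (\<lambda>x. poly_fun_of f x * poly_fun_of g x)"
  "poly_fun_of (central_const d) = (\<lambda>x. d)"
  "poly_fun_of (central_var (i, j)) = coord_fun v b i j"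
  "poly_fun_of 0 = (\<lambda>x. 0)"
  by (simp_all add: poly_fun_of_def central_eval_add central_eval_mult of_center_coords)

lemma poly_fun_of_combination:
  "poly_fun_of g (\<lambda>i. \<Sum>j\<in>UNIV. center_scale (a i j) (v j)) = central_eval g (\<lambda>(i, j). a i j)"
  by (simp add: poly_fun_of_def coords_combination)

text \<open>Every point of \<open>F\<^bsup>n m\<^esup>\<close> is the coordinate vector of a point of \<open>D\<^sup>n\<close>, so a central polynomial in the
  kernel vanishes everywhere on \<open>F\<^bsup>n m\<^esup>\<close>.\<close>

lemma inj_poly_fun_of:
  assumes "infinite (UNIV :: 'a center set)"
  shows "inj (poly_fun_of :: ('a, 'n :: finite \<times> 'm) central_poly \<Rightarrow> _)"
proof
  fix f g :: "('a, 'n \<times> 'm) central_poly"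
  assume eq: "poly_fun_of f = poly_fun_of g"
  have "central_eval f c = central_eval g c" for c
    using poly_fun_of_combination[of f "curry c"] poly_fun_of_combination[of g "curry c"]
    by (simp add: eq)
  then show "f = g" by (rule central_eval_eq_imp_eq[OF assms])
qed

text \<open>Both rings are generated by the constants together with the coordinate functions on one side and
  the projections on the other. Coordinate functions are polynomial by the coordinate formula, and
  projections are recovered from them as \<open>x\<^sub>i = \<Sum>\<^sub>j Y\<^sub>i\<^sub>j v\<^sub>j\<close>.\<close>

lemma range_poly_fun_of: "range (poly_fun_of :: ('a, 'n :: finite \<times> 'm) central_poly \<Rightarrow> _) = poly_funs"
proof (intro equalityI subsetI)
  fix f :: "('n \<Rightarrow> 'a) \<Rightarrow> 'a"
  assume "f \<in> range poly_fun_of"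
  then obtain g where "f = poly_fun_of g" by blast
  moreover have "poly_fun_of g \<in> poly_funs"
  proof (induction g rule: central_poly_generated)
    case (var p)
    then show ?case by (cases p) (simp add: poly_fun_of_simps coord_fun_in_poly_funs)
  qed (simp_all add: poly_fun_of_simps poly_funs_const poly_funs_add poly_funs_mult)
  ultimately show "f \<in> poly_funs" by simp
next
  fix f :: "('n \<Rightarrow> 'a) \<Rightarrow> 'a"
  assume "f \<in> poly_funs"
  then show "f \<in> range poly_fun_of"
  proof (induction rule: poly_funs_generated)
    case (const d)
    show ?case
      by (rule range_eqI[of _ _ "central_const d :: ('a, 'n \<times> 'm) central_poly"])
        (simp add: poly_fun_of_simps)
  next
    case (proj i)
    have sum: "poly_fun_of (\<Sum>j\<in>A. central_var (i, j) * central_const (v j))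
        = (\<lambda>x. \<Sum>j\<in>A. coord_fun v b i j x * v j)" for A
      by (induction A rule: infinite_finite_induct)
        (simp_all add: poly_fun_of_simps)
    have "(\<lambda>x. \<Sum>j\<in>UNIV. coord_fun v b i j x * v j) = (\<lambda>x. x i)"
      using coords_expansion by (simp add: of_center_coords[symmetric] center_scale_def)
    with sum[of UNIV] show ?case by (metis (no_types) rangeI)
  next
    case (add f g)
    then obtain p q where "f = poly_fun_of p" "g = poly_fun_of q" by blast
    then show ?case by (intro range_eqI[of _ _ "p + q"]) (simp add: poly_fun_of_simps)
  next
    case (mult f g)
    then obtain p q where "f = poly_fun_of p" "g = poly_fun_of q" by blast
    then show ?case by (intro range_eqI[of _ _ "p * q"]) (simp add: poly_fun_of_simps)
  qed
qed

text \<open>An isomorphism with the required values composed with \<open>poly_fun_of\<close> is an endomorphism of the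
  ring of central polynomials that fixes its generators. This gives uniqueness, and it transfers the
  evaluation formula of \<open>poly_fun_of\<close> to every such isomorphism.\<close>

lemma poly_fun_iso_inverts_poly_fun_of:
  assumes \<phi>: "\<phi> \<in> poly_fun_isos" and var: "\<And>(i :: 'n :: finite) j. \<phi> (coord_fun v b i j) = central_var (i, j)"
  shows "\<phi> (poly_fun_of g) = g"
proof -
  have mem: "poly_fun_of f \<in> poly_funs" for f :: "('a, 'n \<times> 'm) central_poly"
    using range_poly_fun_of by blast
  have hom: "\<phi> \<in> ring_hom poly_fun_ring central_poly_ring" and const: "\<And>d. \<phi> (\<lambda>x. d) = central_const d"
    using \<phi> by (auto simp: poly_fun_isos_def ring_iso_def)
  have add: "\<phi> (\<lambda>x. f x + h x) = \<phi> f + \<phi> h" and mult: "\<phi> (\<lambda>x. f x * h x) = \<phi> f * \<phi> h"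
    if "f \<in> poly_funs" "h \<in> poly_funs" for f h
    using ring_hom_add[OF hom, of f h] ring_hom_mult[OF hom, of f h] that
    by (simp_all add: poly_fun_ring_def central_poly_ring_def ring_of_type_algebra_def)
  show ?thesis
  proof (induction g rule: central_poly_generated)
    case (var p)
    then show ?case using assms(2) by (cases p) (simp add: poly_fun_of_simps)
  qed (simp_all add: poly_fun_of_simps const add mult mem)
qed

lemma inverse_poly_fun_of_is_iso:
  assumes "infinite (UNIV :: 'a center set)"
  shows "restrict (inv_into UNIV poly_fun_of) poly_funs \<in>
    (poly_fun_isos :: ((('n :: finite \<Rightarrow> 'a) \<Rightarrow> 'a) \<Rightarrow> ('a, 'n \<times> 'm) central_poly) set)"
    (is "?\<phi> \<in> _")
proof -
  let ?E = "poly_fun_of :: ('a, 'n \<times> 'm) central_poly \<Rightarrow> _"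
  note inj = inj_poly_fun_of[OF assms, where ?'n = 'n]
  have mem: "?E g \<in> poly_funs" for g using range_poly_fun_of by blast
  have inv: "?\<phi> (?E g) = g" for g using inj mem by simp
  have ex: "\<exists>g. f = ?E g" if "f \<in> poly_funs" for f using that range_poly_fun_of by blast
  have add: "?\<phi> (\<lambda>x. f x + h x) = ?\<phi> f + ?\<phi> h" and mult: "?\<phi> (\<lambda>x. f x * h x) = ?\<phi> f * ?\<phi> h"
    if fh: "f \<in> poly_funs" "h \<in> poly_funs" for f h
  proof -
    obtain p q where "f = ?E p" "h = ?E q" using ex fh by blast
    then show "?\<phi> (\<lambda>x. f x + h x) = ?\<phi> f + ?\<phi> h" "?\<phi> (\<lambda>x. f x * h x) = ?\<phi> f * ?\<phi> h"
      using inv[of p] inv[of q] inv[of "p + q"] inv[of "p * q"]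
      by (simp_all only: poly_fun_of_simps)
  qed
  have const: "?\<phi> (\<lambda>x. d) = central_const d" for d
    using inv[of "central_const d"] by (simp only: poly_fun_of_simps)
  have "?E (?\<phi> f) = f" if f: "f \<in> poly_funs" for f
  proof -
    obtain g where "f = ?E g" using ex[OF f] by blast
    then show ?thesis using inv[of g] by (simp only:)
  qed
  then have "bij_betw ?\<phi> poly_funs UNIV"
    by (intro bij_betwI[where g = ?E] Pi_I mem inv UNIV_I)
  moreover have "?\<phi> \<in> ring_hom poly_fun_ring central_poly_ring"
    by (rule ring_hom_memI)
      (use add mult const[of 1] in \<open>simp_all add: poly_fun_ring_def central_poly_ring_def
        ring_of_type_algebra_def central_const_one del: restrict_apply\<close>)
  ultimately show ?thesis
    using const by (simp add: poly_fun_isos_def ring_iso_def poly_fun_ring_def central_poly_ring_def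
        ring_of_type_algebra_def del: restrict_apply)
qed

end

theorem theorem5:
  fixes v :: "'m :: finite \<Rightarrow> 'a :: division_ring"
    and b :: "'m \<Rightarrow> 'm \<Rightarrow> 'm \<Rightarrow> 'a center"
  assumes "card (UNIV :: 'm set) > 1"
    and "center_basis v"
    and "\<forall>x c. x = (\<Sum>k\<in>UNIV. center_scale (c k) (v k)) \<longrightarrow>
      (\<forall>i. of_center (c i) = (\<Sum>s\<in>UNIV. \<Sum>t\<in>UNIV. center_scale (b i s t) (v s * x * v t)))"
  shows "(\<exists>!\<phi>. \<phi> \<in> poly_fun_isos \<and>
      (\<forall>(i :: 'n :: finite) j. \<phi> (coord_fun v b i j) = central_var (i, j))) \<and>
    (\<forall>\<phi>. \<phi> \<in> poly_fun_isos \<and>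
      (\<forall>(i :: 'n) j. \<phi> (coord_fun v b i j) = central_var (i, j)) \<longrightarrow>
      (\<forall>(a :: 'n \<Rightarrow> 'm \<Rightarrow> 'a center). \<forall>f \<in> poly_funs.
        f (\<lambda>i. \<Sum>j\<in>UNIV. center_scale (a i j) (v j)) = central_eval (\<phi> f) (\<lambda>(i, j). a i j)))"
proof -
  interpret center_coordinates v b
    by standard (use assms in blast)+
  have inf: "infinite (UNIV :: 'a center set)" by (rule infinite_center[OF assms(1,2)])
  let ?E = "poly_fun_of :: ('a, 'n \<times> 'm) central_poly \<Rightarrow> _"
  let ?\<phi> = "restrict (inv_into UNIV ?E) poly_funs"
  let ?P = "\<lambda>\<phi>. \<phi> \<in> poly_fun_isos \<and> (\<forall>(i :: 'n) j. \<phi> (coord_fun v b i j) = central_var (i, j))"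
  have ex: "\<exists>g. f = ?E g" if "f \<in> poly_funs" for f using that range_poly_fun_of by blast
  have inverts: "\<phi> (?E g) = g" if "?P \<phi>" for \<phi> g
    using poly_fun_iso_inverts_poly_fun_of that by blast
  have "?\<phi> (coord_fun v b i j) = central_var (i, j)" for i :: 'n and j
    using inv_into_f_f[OF inj_poly_fun_of[OF inf] UNIV_I, of "central_var (i, j)"]
    by (simp add: coord_fun_in_poly_funs poly_fun_of_simps)
  then have exists: "?P ?\<phi>" using inverse_poly_fun_of_is_iso[OF inf] by blast
  have unique: "\<phi> = ?\<phi>" if "?P \<phi>" for \<phi>
  proof (rule extensionalityI)
    show "\<phi> \<in> extensional poly_funs" "?\<phi> \<in> extensional poly_funs"
      using that exists by (auto simp: poly_fun_isos_def)
    show "\<phi> f = ?\<phi> f" if "f \<in> poly_funs" for f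
      using ex[OF that] inverts[OF \<open>?P \<phi>\<close>] inverts[OF exists] by metis
  qed
  have "f (\<lambda>i. \<Sum>j\<in>UNIV. center_scale (a i j) (v j)) = central_eval (\<phi> f) (\<lambda>(i, j). a i j)"
    if "?P \<phi>" "f \<in> poly_funs" for \<phi> a f
    using ex[OF that(2)] inverts[OF that(1)] poly_fun_of_combination by metis
  then show ?thesis using exists unique by blast
qed

end
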